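(* Let $\lambda>0$, $\rho\in\mathbb{C}$, $x\in\mathbb{R}$ and $\psi,\phi\in(0,\pi)$. Then $$ e^\rho\ {}_1F_1\!\left(\begin{matrix}\lambda+ix\\ 2\lambda\end{matrix};(e^{-2i\phi}-1)\rho\right) =\exp\!\left(\frac{\rho\,e^{-i\phi}\sin(\psi-\phi)}{\sin\psi}\right)\sum_{k=0}^\infty\frac{\sin^k\phi}{\sin^k\psi}\,\frac{P_k^{(\lambda)}(x;\psi)}{(2\lambda)_k\,e^{ik\phi}}\,\rho^k. $$
   Context: The Pochhammer symbol is $(z)_n=\prod_{i=1}^n(z+i-1)$ (so $(z)_0=1$), and ${}_pF_q(a_1,\dots,a_p;b_1,\dots,b_q;z)=\sum_{n\ge0}\frac{(a_1)_n\cdots(a_p)_n}{(b_1)_n\cdots(b_q)_n}\frac{z^n}{n!}$. The Meixner-Pollaczek polynomials are $$P_n^{(\lambda)}(x;\phi)=\frac{(2\lambda)_n}{n!}e^{in\phi}\ {}_2F_1\!\left(\begin{matrix}-n,\ \lambda+ix\\ 2\lambda\end{matrix};1-e^{-2i\phi}\right).$$ *)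

theory Defs
  imports "HOL-Analysis.Analysis"
begin

text \<open>
  The value of the generalised hypergeometric series: \<open>fps_hypergeo as bs 1\<close> is the library's formal
  series, and \<open>eval_fps\<close> sums it at \<open>z\<close>. As usual, the value is meaningful only if the series
  converges and no lower parameter is a nonpositive integer.
\<close>

definition hypergeometric :: "complex list \<Rightarrow> complex list \<Rightarrow> complex \<Rightarrow> complex" where
  "hypergeometric as bs z = eval_fps (fps_hypergeo as bs 1) z"

lemma hypergeometric_altdef:
  "hypergeometric as bs z =
     (\<Sum>n. (\<Prod>a\<leftarrow>as. pochhammer a n) / (\<Prod>b\<leftarrow>bs. pochhammer b n) * (z ^ n / fact n))"
proof -
  have "foldl (\<lambda>r a. r * pochhammer a n) c xs = c * (\<Prod>a\<leftarrow>xs. pochhammer a n)"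
    for c :: complex and xs n
    by (induction xs arbitrary: c) (simp_all add: mult.assoc)
  then show ?thesis
    by (simp add: hypergeometric_def eval_fps_def mult_ac)
qed

definition meixner_pollaczek :: "nat \<Rightarrow> real \<Rightarrow> real \<Rightarrow> real \<Rightarrow> complex" where
  "meixner_pollaczek n lam x \<phi> =
     pochhammer (2 * of_real lam) n / fact n * exp (\<i> * of_nat n * of_real \<phi>) *
     hypergeometric [- of_nat n, of_real lam + \<i> * of_real x] [2 * of_real lam]
       (1 - exp (- 2 * \<i> * of_real \<phi>))"

end

theory Submission
  imports Defs
begin

text \<open>
  Expanding \<open>2F1(-k, a; b; z)\<close> binomially shows that \<open>e\<^sup>t 1F1(a; b; -z t)\<close> is the Cauchy product whose
  \<open>k\<close>-th term is \<open>t\<^sup>k / k! 2F1(-k, a; b; z)\<close>. The Meixner-Pollaczek series is the case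
  \<open>z = 1 - e\<^bsup>-2i\<psi>\<^esup>\<close>, \<open>t = \<rho> e\<^bsup>i(\<psi>-\<phi>)\<^esup> sin \<phi> / sin \<psi>\<close>. Then \<open>z t = (1 - e\<^bsup>-2i\<phi>\<^esup>) \<rho>\<close> no longer involves
  \<open>\<psi>\<close>, and the remaining exponential factor is \<open>e\<^bsup>\<rho> - t\<^esup>\<close>.
\<close>

text \<open>The quotient is a product of factors \<open>(a + of_nat i) / (b + of_nat i)\<close>,
  which tend to 1 and so have a common bound \<open>M\<close>. Geometric growth is all that the
  factorial in the 1F1 series has to beat.\<close>

lemma norm_pochhammer_divide_bound:
  fixes a b :: complex
  assumes "b \<notin> \<int>\<^sub>\<le>\<^sub>0"
  obtains M where "\<And>n. norm (pochhammer a n / pochhammer b n) \<le> M ^ n"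
proof -
  have "(\<lambda>n. 1 + (a - b) / (b + of_nat n)) \<longlonglongrightarrow> 1 + 0"
    by (intro tendsto_intros tendsto_divide_0[OF tendsto_const]
        tendsto_add_filterlim_at_infinity[OF tendsto_const tendsto_of_nat])
  moreover have "1 + (a - b) / (b + of_nat n) = (a + of_nat n) / (b + of_nat n)" for n
  proof -
    have "b + of_nat n \<noteq> 0"
      using assms plus_of_nat_eq_0_imp by blast
    then show ?thesis by (simp add: field_simps)
  qed
  ultimately have "Bseq (\<lambda>n. (a + of_nat n) / (b + of_nat n))"
    by (auto intro: convergent_imp_Bseq convergentI)
  then obtain M where M: "\<And>n. norm ((a + of_nat n) / (b + of_nat n)) \<le> M"
    by (auto simp: Bseq_def)
  have "norm (pochhammer a n / pochhammer b n) \<le> M ^ n" for n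
  proof (induction n)
    case (Suc n)
    have "norm (pochhammer a (Suc n) / pochhammer b (Suc n)) =
        norm (pochhammer a n / pochhammer b n) * norm ((a + of_nat n) / (b + of_nat n))"
      by (simp add: pochhammer_Suc norm_mult norm_divide)
    also have "\<dots> \<le> M ^ n * M"
      \<comment> \<open>\<open>M ^ n\<close> is nonnegative because the induction hypothesis makes
        it an upper bound of a norm.\<close>
      using Suc M by (intro mult_mono) (auto intro: order_trans[OF norm_ge_zero])
    finally show ?case by (simp add: mult.commute)
  qed simp
  then show ?thesis using that by blast
qed

text \<open>By the geometric bound, the series is dominated by the exponential series at
  \<open>M * norm w\<close>.\<close>

lemma summable_norm_1F1:
  fixes a b w :: complex
  assumes "b \<notin> \<int>\<^sub>\<le>\<^sub>0"
  shows "summable (\<lambda>n. norm (pochhammer a n / pochhammer b n * (w ^ n / fact n)))"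
proof -
  obtain M where M: "\<And>n. norm (pochhammer a n / pochhammer b n) \<le> M ^ n"
    using norm_pochhammer_divide_bound[OF assms] by blast
  show ?thesis
  proof (rule summable_comparison_test', rule summable_exp)
    fix n :: nat
    have "norm (pochhammer a n / pochhammer b n * (w ^ n / fact n)) \<le> M ^ n * (norm w ^ n / fact n)"
      unfolding norm_mult[of _ "w ^ n / fact n"]
      using mult_right_mono[OF M[of n], of "norm w ^ n / fact n"]
      by (simp add: norm_divide norm_power)
    then show "norm (norm (pochhammer a n / pochhammer b n * (w ^ n / fact n)))
        \<le> inverse (fact n) * (M * norm w) ^ n"
      by (simp add: power_mult_distrib field_simps)
  qed
qed

text \<open>\<open>pochhammer (- of_nat k) j\<close> vanishes for \<open>j > k\<close>, which
  truncates the series; for \<open>j \<le> k\<close>, dividing it by \<open>fact j\<close> gives the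
  binomial coefficient up to \<open>(- 1) ^ j\<close>, and that sign is absorbed into
  \<open>(- z) ^ j\<close>.\<close>

lemma hypergeometric_2F1_neg_nat:
  "hypergeometric [- of_nat k, a] [b] z =
     (\<Sum>j\<le>k. of_nat (k choose j) * (pochhammer a j / pochhammer b j * (- z) ^ j))"
proof -
  have "hypergeometric [- of_nat k, a] [b] z =
      (\<Sum>j\<le>k. pochhammer (- of_nat k) j * pochhammer a j / pochhammer b j * (z ^ j / fact j))"
    unfolding hypergeometric_altdef
    by (subst suminf_finite[of "{..k}"]) (auto simp: pochhammer_of_nat_eq_0_lemma)
  also have "\<dots> = (\<Sum>j\<le>k. of_nat (k choose j) * (pochhammer a j / pochhammer b j * (- z) ^ j))"
  proof (rule sum.cong)
    fix j
    have "(of_nat (k choose j) :: complex) = (- 1) ^ j * pochhammer (- of_nat k) j / fact j"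
      by (simp add: binomial_gbinomial gbinomial_pochhammer)
    moreover have "z ^ j = (- 1) ^ j * (- z) ^ j"
      by (simp flip: power_mult_distrib)
    ultimately show "pochhammer (- of_nat k) j * pochhammer a j / pochhammer b j * (z ^ j / fact j) =
        of_nat (k choose j) * (pochhammer a j / pochhammer b j * (- z) ^ j)"
      by (simp add: mult_ac)
  qed simp
  finally show ?thesis .
qed

text \<open>Absolute convergence of both factors justifies the Cauchy product. Stating the result
  with \<open>sums\<close> provides summability and the value together.\<close>

lemma exp_times_1F1_sums:
  fixes a b z t :: complex
  assumes "b \<notin> \<int>\<^sub>\<le>\<^sub>0"
  shows "(\<lambda>k. t ^ k / fact k * hypergeometric [- of_nat k, a] [b] z) sums
           (exp t * hypergeometric [a] [b] (- z * t))"
proof -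
  let ?f = "\<lambda>j. pochhammer a j / pochhammer b j * ((- z * t) ^ j / fact j)"
  let ?e = "\<lambda>j. t ^ j / fact j"
  have "summable (\<lambda>j. norm (?e j))"
    using summable_norm_exp[of t] by (simp add: field_simps scaleR_conv_of_real)
  from Cauchy_product_sums[OF summable_norm_1F1[OF assms] this]
  have "(\<lambda>k. \<Sum>j\<le>k. ?f j * ?e (k - j)) sums ((\<Sum>j. ?f j) * (\<Sum>j. ?e j))" .
  moreover have "(\<Sum>j\<le>k. ?f j * ?e (k - j)) = t ^ k / fact k * hypergeometric [- of_nat k, a] [b] z"
    for k
    unfolding hypergeometric_2F1_neg_nat sum_distrib_left
  proof (rule sum.cong)
    fix j assume "j \<in> {..k}"
    then have "j \<le> k" by simp
    \<comment> \<open>The factor \<open>1 / fact k\<close> turns the binomial coefficient into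
      \<open>1 / (fact j * fact (k - j))\<close>, the two factorials of the convolution.\<close>
    then have "(of_nat (k choose j) :: complex) = fact k / (fact j * fact (k - j))"
      by (rule binomial_fact)
    moreover have "t ^ k = t ^ j * t ^ (k - j)"
      using \<open>j \<le> k\<close> by (simp flip: power_add)
    ultimately show "?f j * ?e (k - j) =
        t ^ k / fact k * (of_nat (k choose j) * (pochhammer a j / pochhammer b j * (- z) ^ j))"
      by (simp only: power_mult_distrib) (simp add: mult_ac)
  qed simp
  moreover have "(\<Sum>j. ?e j) = exp t"
    by (simp add: exp_def scaleR_conv_of_real field_simps)
  moreover have "(\<Sum>j. ?f j) = hypergeometric [a] [b] (- z * t)"
    by (simp add: hypergeometric_altdef)
  ultimately show ?thesis
    by (simp add: mult.commute)
qed

text \<open>This factorisation exposes the sine, so that \<open>sin \<psi>\<close> in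
  \<open>z\<close> can cancel against the denominator of \<open>t\<close>.\<close>

lemma exp_neg_double_angle:
  "exp (- 2 * \<i> * of_real \<theta>) - 1 = - 2 * \<i> * of_real (sin \<theta>) * exp (- \<i> * of_real \<theta>)"
proof -
  have "- 2 * \<i> * of_real (sin \<theta>) = - (exp (\<i> * of_real \<theta>) - exp (- \<i> * of_real \<theta>))"
    by (simp add: sin_of_real[symmetric] sin_exp_eq)
  then have "- 2 * \<i> * of_real (sin \<theta>) * exp (- \<i> * of_real \<theta>) =
      - ((exp (\<i> * of_real \<theta>) - exp (- \<i> * of_real \<theta>)) * exp (- \<i> * of_real \<theta>))"
    by (simp only: mult_minus_left)
  also have "\<dots> = exp (- 2 * \<i> * of_real \<theta>) - 1"
    by (simp add: left_diff_distrib mult.assoc flip: exp_add)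
  finally show ?thesis ..
qed

theorem theorem5p4:
  fixes lam x \<psi> \<phi> :: real and \<rho> :: complex
  assumes "lam > 0" and "\<psi> \<in> {0<..<pi}" and "\<phi> \<in> {0<..<pi}"
  shows "summable (\<lambda>k. of_real (sin \<phi> ^ k / sin \<psi> ^ k) *
             (meixner_pollaczek k lam x \<psi> /
               (pochhammer (2 * of_real lam) k * exp (\<i> * of_nat k * of_real \<phi>))) * \<rho> ^ k)
       \<and> exp \<rho> * hypergeometric [of_real lam + \<i> * of_real x] [2 * of_real lam]
             ((exp (- 2 * \<i> * of_real \<phi>) - 1) * \<rho>)
         = exp (\<rho> * exp (- \<i> * of_real \<phi>) * of_real (sin (\<psi> - \<phi>)) / of_real (sin \<psi>)) *
           (\<Sum>k. of_real (sin \<phi> ^ k / sin \<psi> ^ k) *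
             (meixner_pollaczek k lam x \<psi> /
               (pochhammer (2 * of_real lam) k * exp (\<i> * of_nat k * of_real \<phi>))) * \<rho> ^ k)"
proof -
  define a b z t :: complex where "a = of_real lam + \<i> * of_real x" and "b = 2 * of_real lam"
    and "z = 1 - exp (- 2 * \<i> * of_real \<psi>)"
    and "t = of_real (sin \<phi> / sin \<psi>) * exp (\<i> * of_real \<psi>) / exp (\<i> * of_real \<phi>) * \<rho>"
  let ?c = "\<rho> * exp (- \<i> * of_real \<phi>) * of_real (sin (\<psi> - \<phi>)) / of_real (sin \<psi>)"
  let ?g = "\<lambda>k. of_real (sin \<phi> ^ k / sin \<psi> ^ k) *
             (meixner_pollaczek k lam x \<psi> /
               (pochhammer (2 * of_real lam) k * exp (\<i> * of_nat k * of_real \<phi>))) * \<rho> ^ k"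
  have sin: "sin \<psi> > 0"
    using assms by (simp add: sin_gt_zero)
  have b: "b \<notin> \<int>\<^sub>\<le>\<^sub>0"
    using \<open>lam > 0\<close> by (auto simp: b_def complex_eq_iff elim!: nonpos_Ints_cases)
  have g: "?g k = t ^ k / fact k * hypergeometric [- of_nat k, a] [b] z" for k
  proof -
    \<comment> \<open>Needed to cancel \<open>pochhammer b k\<close> in the normalisation of the
      polynomial against the denominator of \<open>?g k\<close>.\<close>
    have "pochhammer b k \<noteq> 0"
      using b by (auto simp: pochhammer_eq_0_iff)
    have "exp (\<i> * of_nat k * of_real \<theta>) = exp (\<i> * of_real \<theta>) ^ k" for \<theta>
      by (simp add: mult_ac flip: exp_of_nat_mult)
    with \<open>pochhammer b k \<noteq> 0\<close> have "?g k = of_real (sin \<phi>) ^ k *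
        (exp (\<i> * of_real \<psi>) ^ k * hypergeometric [- of_nat k, a] [b] z) * \<rho> ^ k /
        (of_real (sin \<psi>) ^ k * (fact k * exp (\<i> * of_real \<phi>) ^ k))"
      by (simp add: meixner_pollaczek_def a_def b_def z_def)
    also have "\<dots> = t ^ k / fact k * hypergeometric [- of_nat k, a] [b] z"
      by (simp add: t_def power_mult_distrib power_divide) (simp only: mult_ac)
    finally show ?thesis .
  qed
  have zt: "- z * t = (exp (- 2 * \<i> * of_real \<phi>) - 1) * \<rho>"
  proof -
    have "- z * t = - 2 * \<i> * of_real (sin \<psi>) * exp (- \<i> * of_real \<psi>) * t"
      unfolding z_def by (simp only: minus_diff_eq exp_neg_double_angle)
    \<comment> \<open>Both \<open>sin \<psi>\<close> and the phase in \<open>\<psi>\<close> cancel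
      against \<open>t\<close>, leaving the same factorisation with \<open>\<phi>\<close> in place
      of \<open>\<psi>\<close>.\<close>
    also have "\<dots> = - 2 * \<i> * of_real (sin \<phi>) * exp (- \<i> * of_real \<phi>) * \<rho>"
      using sin by (simp add: t_def exp_minus divide_simps)
    finally show ?thesis
      by (simp only: exp_neg_double_angle)
  qed
  have c: "?c + t = \<rho>"
  proof -
    \<comment> \<open>The real part is the subtraction formula for the sine; the imaginary parts are
      both \<open>sin \<phi> * sin \<psi>\<close>.\<close>
    have "of_real (sin (\<psi> - \<phi>)) + of_real (sin \<phi>) * exp (\<i> * of_real \<psi>) =
        of_real (sin \<psi>) * exp (\<i> * of_real \<phi>)"
      by (simp add: complex_eq_iff sin_diff Re_exp Im_exp)
    then have "\<rho> * exp (- \<i> * of_real \<phi>) *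
        (of_real (sin (\<psi> - \<phi>)) + of_real (sin \<phi>) * exp (\<i> * of_real \<psi>)) / of_real (sin \<psi>) = \<rho>"
      using sin by (simp add: exp_minus)
    then show ?thesis
      by (simp add: t_def exp_minus divide_inverse distrib_left distrib_right mult_ac)
  qed
  have "?g sums (exp t * hypergeometric [a] [b] (- z * t))"
    unfolding g by (rule exp_times_1F1_sums[OF b])
  moreover have "exp \<rho> = exp ?c * exp t"
    by (simp only: c flip: exp_add)
  ultimately show ?thesis
    unfolding zt a_def b_def by (simp only: sums_iff mult.assoc simp_thms)
qed

end
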